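(* Let $p$ and $q$ be two distinct prime numbers. Then the lattice of all $(\mathbb{Z}_p,\mathbb{Z}_q)$-linearly closed clonoids is embedded (as a lattice, i.e. via an injective lattice homomorphism) in the lattice of all clones on $\mathbb{Z}_{pq}$ containing $\mathrm{Clo}(\langle \mathbb{Z}_{pq},+\rangle)$.
   Context: $\mathbb{N}$ is the set of positive integers. A clone on a set $A$ is a set of finitary operations on $A$ containing all projections and closed under composition; clones are ordered by inclusion. $\mathrm{Clo}(\langle \mathbb{Z}_n,+\rangle)$ is the clone on $\mathbb{Z}_n$ generated by the addition. For a set $C\subseteq \bigcup_{n\in\mathbb{N}}\mathbb{Z}_p^{\mathbb{Z}_q^n}$ let $C^{[n]}$ be the set of $n$-ary members of $C$. A $(\mathbb{Z}_p,\mathbb{Z}_q)$-linearly closed clonoid is a non-empty subset $C$ of $\bigcup_{n\in\mathbb{N}}\mathbb{Z}_p^{\mathbb{Z}_q^n}$ such that: (1) for all $n\in\mathbb{N}$, $f,g\in C^{[n]}$ and $a,b\in\mathbb{Z}_p$: $af+bg\in C^{[n]}$; (2) for all $m,n\in\mathbb{N}$, $f\in C^{[m]}$ and $A\in\mathbb{Z}_q^{m\times n}$, the function $(x_1,\dots,x_n)\mapsto f(A\cdot(x_1,\dots,x_n)^t)$ is in $C^{[n]}$. These clonoids form a lattice under inclusion. *)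

theory Defs
  imports "HOL-Algebra.Lattice" "HOL-Number_Theory.Residues"
begin

section \<open>Finitary functions\<close>

definition tuples :: "'a set \<Rightarrow> nat \<Rightarrow> (nat \<Rightarrow> 'a) set"
  where "tuples A n = {..<n} \<rightarrow>\<^sub>E A"

text \<open>A finitary function from \<open>A\<close> to \<open>B\<close> is represented by the pair of its arity and an
  extensional function on tuples. The arity is recorded explicitly because extensional functions
  with different domains may coincide in HOL (when they take the value \<open>undefined\<close>).\<close>

type_synonym ('a, 'b) finfun = "nat \<times> ((nat \<Rightarrow> 'a) \<Rightarrow> 'b)"

definition finitary_functions :: "'a set \<Rightarrow> 'b set \<Rightarrow> ('a, 'b) finfun set"
  where "finitary_functions A B = {(n, f). 0 < n \<and> f \<in> tuples A n \<rightarrow>\<^sub>E B}"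

definition arity_part :: "('a, 'b) finfun set \<Rightarrow> nat \<Rightarrow> ((nat \<Rightarrow> 'a) \<Rightarrow> 'b) set"
  where "arity_part C n = {f. (n, f) \<in> C}"

section \<open>Clones\<close>

definition projection :: "'a set \<Rightarrow> nat \<Rightarrow> nat \<Rightarrow> (nat \<Rightarrow> 'a) \<Rightarrow> 'a"
  where "projection A n i = (\<lambda>x\<in>tuples A n. x i)"

definition composition ::
  "'a set \<Rightarrow> nat \<Rightarrow> nat \<Rightarrow> ((nat \<Rightarrow> 'a) \<Rightarrow> 'a) \<Rightarrow> (nat \<Rightarrow> (nat \<Rightarrow> 'a) \<Rightarrow> 'a) \<Rightarrow> (nat \<Rightarrow> 'a) \<Rightarrow> 'a"
  where "composition A m n f g = (\<lambda>x\<in>tuples A n. f (\<lambda>i\<in>{..<m}. g i x))"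

definition is_clone :: "'a set \<Rightarrow> ('a, 'a) finfun set \<Rightarrow> bool"
  where "is_clone A C \<longleftrightarrow>
    C \<subseteq> finitary_functions A A \<and>
    (\<forall>n>0. \<forall>i<n. projection A n i \<in> arity_part C n) \<and>
    (\<forall>m>0. \<forall>n>0. \<forall>f\<in>arity_part C m. \<forall>g\<in>{..<m} \<rightarrow> arity_part C n.
      composition A m n f g \<in> arity_part C n)"

definition clone_generated :: "'a set \<Rightarrow> ('a, 'a) finfun set \<Rightarrow> ('a, 'a) finfun set"
  where "clone_generated A F = \<Inter>{C. is_clone A C \<and> F \<subseteq> C}"

definition addition_clone :: "('a, 'm) ring_scheme \<Rightarrow> ('a, 'a) finfun set"
  where "addition_clone R =
    clone_generated (carrier R) {(2, \<lambda>x\<in>tuples (carrier R) 2. x 0 \<oplus>\<^bsub>R\<^esub> x 1)}"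

section \<open>Linearly closed clonoids\<close>

definition mat_tuple_mult ::
  "('b, 'm) ring_scheme \<Rightarrow> nat \<Rightarrow> nat \<Rightarrow> (nat \<Rightarrow> nat \<Rightarrow> 'b) \<Rightarrow> (nat \<Rightarrow> 'b) \<Rightarrow> nat \<Rightarrow> 'b"
  where "mat_tuple_mult S m n A x = (\<lambda>i\<in>{..<m}. \<Oplus>\<^bsub>S\<^esub>j\<in>{..<n}. A i j \<otimes>\<^bsub>S\<^esub> x j)"

definition linearly_closed_clonoid ::
  "('a, 'm) ring_scheme \<Rightarrow> ('b, 'k) ring_scheme \<Rightarrow> ('b, 'a) finfun set \<Rightarrow> bool"
  where "linearly_closed_clonoid R S C \<longleftrightarrow>
    C \<noteq> {} \<and> C \<subseteq> finitary_functions (carrier S) (carrier R) \<and>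
    (\<forall>n>0. \<forall>f\<in>arity_part C n. \<forall>g\<in>arity_part C n. \<forall>a\<in>carrier R. \<forall>b\<in>carrier R.
      (\<lambda>x\<in>tuples (carrier S) n. a \<otimes>\<^bsub>R\<^esub> f x \<oplus>\<^bsub>R\<^esub> b \<otimes>\<^bsub>R\<^esub> g x) \<in> arity_part C n) \<and>
    (\<forall>m>0. \<forall>n>0. \<forall>f\<in>arity_part C m. \<forall>A\<in>{..<m} \<rightarrow> {..<n} \<rightarrow> carrier S.
      (\<lambda>x\<in>tuples (carrier S) n. f (mat_tuple_mult S m n A x)) \<in> arity_part C n)"

section \<open>The two lattices\<close>

definition inclusion_order :: "'a set set \<Rightarrow> 'a set gorder"
  where "inclusion_order X = \<lparr>carrier = X, eq = (=), le = (\<subseteq>)\<rparr>"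

definition clonoid_lattice :: "nat \<Rightarrow> nat \<Rightarrow> (int, int) finfun set gorder"
  where "clonoid_lattice p q = inclusion_order
    {C. linearly_closed_clonoid (residue_ring (int p)) (residue_ring (int q)) C}"

definition clone_lattice_above_addition :: "nat \<Rightarrow> (int, int) finfun set gorder"
  where "clone_lattice_above_addition n = inclusion_order
    {C. is_clone (carrier (residue_ring (int n))) C \<and> addition_clone (residue_ring (int n)) \<subseteq> C}"

text \<open>Note that \<^const>\<open>join_pres\<close> and \<^const>\<open>meet_pres\<close> include the assertion that
  \<open>L\<close> and \<open>M\<close> are lattices.\<close>

definition lattice_embedding ::
  "('a, 'm) gorder_scheme \<Rightarrow> ('b, 'k) gorder_scheme \<Rightarrow> ('a \<Rightarrow> 'b) \<Rightarrow> bool"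
  where "lattice_embedding L M h \<longleftrightarrow>
    h \<in> carrier L \<rightarrow> carrier M \<and> inj_on h (carrier L) \<and> join_pres L M h \<and> meet_pres L M h"

end

theory Submission
  imports Defs
begin

text \<open>Let \<open>N = p q\<close> and let \<open>e\<close> be an integer with \<open>e \<equiv> 1\<close> modulo \<open>p\<close> and \<open>e \<equiv> 0\<close> modulo \<open>q\<close>.
  Multiplication by \<open>e\<close> identifies the integers modulo \<open>p\<close> with a direct summand of the integers
  modulo \<open>N\<close>, and the reduction modulo \<open>q\<close> is the projection onto the complementary summand.
  A function \<open>f\<close> from tuples modulo \<open>q\<close> to residues modulo \<open>p\<close> can therefore be read as the
  operation \<open>x \<mapsto> e f(x mod q)\<close> modulo \<open>N\<close>. The embedding sends a clonoid \<open>C\<close> to the set of all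
  operations \<open>x \<mapsto> c\<^sub>0 x\<^sub>0 + \<dots> + e f(x mod q)\<close> with integer coefficients \<open>c\<^sub>i\<close> and \<open>f\<close> in \<open>C\<close>.

  This set is a clone. The nonlinear part is a multiple of \<open>e\<close>, so it vanishes modulo \<open>q\<close>; hence
  an outer \<open>f\<close> sees only the linear parts of the inner operations, and what arises is a linear
  substitution in \<open>f\<close>. An outer linear form combines the inner nonlinear parts linearly. These are
  the two kinds of closure that a clonoid has.

  In the other direction, a clone \<open>K\<close> containing the addition yields the clonoid of all \<open>f\<close> for
  which \<open>x \<mapsto> e f(x mod q)\<close> lies in \<open>K\<close>. The two maps form a Galois connection, because \<open>K\<close>
  contains all linear forms and is closed under sums. The first map is thus a left adjoint, which
  makes it preserve joins. It preserves intersections and is injective because an operation of the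
  form above determines \<open>f\<close>: on arguments divisible by \<open>p\<close> the linear part vanishes modulo \<open>p\<close>,
  while the reductions modulo \<open>q\<close> of such arguments are arbitrary.\<close>

section \<open>Adjoint embeddings of closure systems\<close>

text \<open>The greatest member \<open>T\<close> provides an upper bound of any two members, so that their join exists
  as the intersection of all upper bounds. Demanding \<open>S \<noteq> {}\<close> avoids the set of all elements of
  the type, which need not consist of finitary functions.\<close>

definition closure_system :: "'a set \<Rightarrow> 'a set set \<Rightarrow> bool"
  where "closure_system T X \<longleftrightarrow>
    T \<in> X \<and> (\<forall>A\<in>X. A \<subseteq> T) \<and> (\<forall>S. S \<subseteq> X \<and> S \<noteq> {} \<longrightarrow> \<Inter>S \<in> X)"

lemma closure_systemI:
  assumes "T \<in> X" "\<And>A. A \<in> X \<Longrightarrow> A \<subseteq> T" "\<And>S. S \<subseteq> X \<Longrightarrow> S \<noteq> {} \<Longrightarrow> \<Inter>S \<in> X"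
  shows "closure_system T X"
  using assms by (simp add: closure_system_def)

lemma closure_system_Inter:
  "closure_system T X \<Longrightarrow> S \<subseteq> X \<Longrightarrow> S \<noteq> {} \<Longrightarrow> \<Inter>S \<in> X"
  by (simp add: closure_system_def)

lemma closure_system_Int:
  assumes "closure_system T X" "A \<in> X" "B \<in> X"
  shows "A \<inter> B \<in> X"
proof -
  have "\<Inter>{A, B} \<in> X"
    by (rule closure_system_Inter[OF assms(1)]) (use assms in auto)
  then show ?thesis by simp
qed

lemma closure_system_hull:
  assumes "closure_system T X" "A \<in> X" "B \<in> X"
  shows "\<Inter>{Z \<in> X. A \<union> B \<subseteq> Z} \<in> X"
proof -
  have "T \<in> {Z \<in> X. A \<union> B \<subseteq> Z}"
    using assms by (auto simp: closure_system_def)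
  then have "{Z \<in> X. A \<union> B \<subseteq> Z} \<noteq> {}" by blast
  then show ?thesis
    by (intro closure_system_Inter[OF assms(1)]) auto
qed

lemma inclusion_order_simps [simp]:
  "carrier (inclusion_order X) = X"
  "le (inclusion_order X) = (\<subseteq>)"
  "eq (inclusion_order X) = (=)"
  by (simp_all add: inclusion_order_def)

lemma partial_order_inclusion: "partial_order (inclusion_order X)"
  by unfold_locales auto

lemma least_hull:
  assumes "closure_system T X" "A \<in> X" "B \<in> X"
  shows "least (inclusion_order X) (\<Inter>{Z \<in> X. A \<union> B \<subseteq> Z}) (Upper (inclusion_order X) {A, B})"
  using closure_system_hull[OF assms] assms(2,3)
  by (auto simp: least_def Upper_def)

lemma greatest_Int:
  assumes "closure_system T X" "A \<in> X" "B \<in> X"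
  shows "greatest (inclusion_order X) (A \<inter> B) (Lower (inclusion_order X) {A, B})"
  using closure_system_Int[OF assms] assms(2,3)
  by (auto simp: greatest_def Lower_def)

lemma lattice_closure_system:
  assumes "closure_system T X"
  shows "lattice (inclusion_order X)"
proof -
  interpret partial_order "inclusion_order X" by (rule partial_order_inclusion)
  show ?thesis
  proof unfold_locales
    fix A B
    assume AB: "A \<in> carrier (inclusion_order X)" "B \<in> carrier (inclusion_order X)"
    show "\<exists>S. least (inclusion_order X) S (Upper (inclusion_order X) {A, B})"
      by (rule exI, rule least_hull[OF assms]) (use AB in simp_all)
    show "\<exists>S. greatest (inclusion_order X) S (Lower (inclusion_order X) {A, B})"
      by (rule exI, rule greatest_Int[OF assms]) (use AB in simp_all)
  qed
qed

lemma join_closure_system: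
  assumes "closure_system T X" "A \<in> X" "B \<in> X"
  shows "A \<squnion>\<^bsub>inclusion_order X\<^esub> B = \<Inter>{Z \<in> X. A \<union> B \<subseteq> Z}"
  unfolding join_def sup_def
  using least_hull[OF assms] partial_order.least_unique[OF partial_order_inclusion _ least_hull[OF assms]]
  by (rule some_equality)

lemma meet_closure_system:
  assumes "closure_system T X" "A \<in> X" "B \<in> X"
  shows "A \<sqinter>\<^bsub>inclusion_order X\<^esub> B = A \<inter> B"
  unfolding meet_def inf_def
  using greatest_Int[OF assms] partial_order.greatest_unique[OF partial_order_inclusion _ greatest_Int[OF assms]]
  by (rule some_equality)

text \<open>Joins are preserved because \<open>h\<close> is a left adjoint, so only intersections and the
  identity \<open>g (h A) = A\<close> have to be known about \<open>h\<close> itself.\<close>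

lemma lattice_embedding_of_adjunction:
  assumes X: "closure_system T X" and Y: "closure_system U Y"
    and h: "h \<in> X \<rightarrow> Y" and g: "g \<in> Y \<rightarrow> X"
    and adj: "\<And>A B. A \<in> X \<Longrightarrow> B \<in> Y \<Longrightarrow> h A \<subseteq> B \<longleftrightarrow> A \<subseteq> g B"
    and gh: "\<And>A. A \<in> X \<Longrightarrow> g (h A) = A"
    and int: "\<And>A B. A \<in> X \<Longrightarrow> B \<in> X \<Longrightarrow> h (A \<inter> B) = h A \<inter> h B"
  shows "lattice_embedding (inclusion_order X) (inclusion_order Y) h"
proof -
  have hY: "h A \<in> Y" if "A \<in> X" for A using h that by auto
  have mono: "h A \<subseteq> h B" if "A \<in> X" "B \<in> X" "A \<subseteq> B" for A B
    using adj[OF that(1) hY[OF that(2)]] gh[OF that(2)] that(3) by simp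
  have inj: "inj_on h X" by (metis gh inj_onI)
  have join: "h (\<Inter>{Z \<in> X. A \<union> B \<subseteq> Z}) = \<Inter>{Z \<in> Y. h A \<union> h B \<subseteq> Z}"
    if A: "A \<in> X" and B: "B \<in> X" for A B
  proof (rule antisym)
    let ?J = "\<Inter>{Z \<in> X. A \<union> B \<subseteq> Z}"
    have J: "?J \<in> X" by (rule closure_system_hull[OF X A B])
    show "h ?J \<subseteq> \<Inter>{Z \<in> Y. h A \<union> h B \<subseteq> Z}"
    proof (rule Inter_greatest)
      fix Z assume Z: "Z \<in> {Z \<in> Y. h A \<union> h B \<subseteq> Z}"
      then have "A \<union> B \<subseteq> g Z" using adj A B by auto
      moreover have "g Z \<in> X" using Z g by auto
      ultimately have "?J \<subseteq> g Z" by blast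
      then show "h ?J \<subseteq> Z" using adj J Z by blast
    qed
    have "h A \<subseteq> h ?J" "h B \<subseteq> h ?J" by (rule mono; use A B J in blast)+
    then show "\<Inter>{Z \<in> Y. h A \<union> h B \<subseteq> Z} \<subseteq> h ?J" using hY[OF J] by blast
  qed
  have "h (A \<squnion>\<^bsub>inclusion_order X\<^esub> B) = h A \<squnion>\<^bsub>inclusion_order Y\<^esub> h B"
    if "A \<in> X" "B \<in> X" for A B
    unfolding join_closure_system[OF X that] join_closure_system[OF Y hY[OF that(1)] hY[OF that(2)]]
    by (rule join[OF that])
  moreover have "h (A \<sqinter>\<^bsub>inclusion_order X\<^esub> B) = h A \<sqinter>\<^bsub>inclusion_order Y\<^esub> h B"
    if "A \<in> X" "B \<in> X" for A B
    unfolding meet_closure_system[OF X that] meet_closure_system[OF Y hY[OF that(1)] hY[OF that(2)]]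
    by (rule int[OF that])
  ultimately show ?thesis
    unfolding lattice_embedding_def join_pres_def meet_pres_def inclusion_order_simps
    using h inj lattice_closure_system[OF X] lattice_closure_system[OF Y] by simp
qed

section \<open>Functions between residue systems\<close>

abbreviation residue_set :: "int \<Rightarrow> int set"
  where "residue_set m \<equiv> {0..m - 1}"

text \<open>The members of clones and clonoids have reduced values and are undefined off their tuples.
  Writing them as the reduction of an unrestricted integer-valued formula lets every identity
  between them be proved as a congruence of integers.\<close>

definition reduced :: "int \<Rightarrow> int \<Rightarrow> nat \<Rightarrow> ((nat \<Rightarrow> int) \<Rightarrow> int) \<Rightarrow> (nat \<Rightarrow> int) \<Rightarrow> int"
  where "reduced m k n \<phi> = (\<lambda>x\<in>tuples (residue_set m) n. \<phi> x mod k)"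

definition reduced_tuple :: "int \<Rightarrow> nat \<Rightarrow> (nat \<Rightarrow> int) \<Rightarrow> nat \<Rightarrow> int"
  where "reduced_tuple m n x = (\<lambda>i\<in>{..<n}. x i mod m)"

lemma reduced_apply [simp]:
  "x \<in> tuples (residue_set m) n \<Longrightarrow> reduced m k n \<phi> x = \<phi> x mod k"
  by (simp add: reduced_def)

lemma reduced_cong:
  "(\<And>x. x \<in> tuples (residue_set m) n \<Longrightarrow> [\<phi> x = \<psi> x] (mod k)) \<Longrightarrow> reduced m k n \<phi> = reduced m k n \<psi>"
  by (auto simp: reduced_def cong_def intro!: restrict_ext)

lemma reduced_in [simp]:
  "k > 1 \<Longrightarrow> reduced m k n \<phi> \<in> tuples (residue_set m) n \<rightarrow>\<^sub>E residue_set k"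
  by (auto simp: reduced_def)

lemma reduced_tuple_in [simp]:
  "m > 1 \<Longrightarrow> reduced_tuple m n x \<in> tuples (residue_set m) n"
  by (auto simp: reduced_tuple_def tuples_def)

lemma reduced_tuple_cong:
  "(\<And>i. i < n \<Longrightarrow> [x i = y i] (mod m)) \<Longrightarrow> reduced_tuple m n x = reduced_tuple m n y"
  by (auto simp: reduced_tuple_def cong_def intro!: restrict_ext)

lemma reduced_tuple_apply: "i < n \<Longrightarrow> reduced_tuple m n x i = x i mod m"
  by (simp add: reduced_tuple_def)

lemma reduced_tuple_self:
  assumes "x \<in> tuples (residue_set m) n"
  shows "reduced_tuple m n x = x"
proof
  fix i show "reduced_tuple m n x i = x i"
    using assms by (cases "i < n")
      (auto simp: reduced_tuple_def tuples_def PiE_def Pi_def extensional_def)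
qed

lemma reduced_self:
  assumes "f \<in> tuples (residue_set m) n \<rightarrow>\<^sub>E residue_set k"
  shows "reduced m k n f = f"
proof
  fix x show "reduced m k n f x = f x"
  proof (cases "x \<in> tuples (residue_set m) n")
    case True
    then have "f x \<in> residue_set k" using assms by blast
    then show ?thesis using True by simp
  qed (use assms in \<open>auto simp: reduced_def PiE_def extensional_def\<close>)
qed

lemma reduced_eqI:
  assumes "f \<in> tuples (residue_set m) n \<rightarrow>\<^sub>E residue_set k"
    and "\<And>x. x \<in> tuples (residue_set m) n \<Longrightarrow> [f x = \<phi> x] (mod k)"
  shows "f = reduced m k n \<phi>"
  using reduced_cong[of m n f \<phi> k] assms by (simp add: reduced_self)

lemma carrier_residue_ring [simp]: "carrier (residue_ring m) = residue_set m"
  by (simp add: residue_ring_def)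

section \<open>Clones of operations modulo N\<close>

lemma finitary_functionsD:
  "C \<subseteq> finitary_functions A B \<Longrightarrow> f \<in> arity_part C n \<Longrightarrow> 0 < n \<and> f \<in> tuples A n \<rightarrow>\<^sub>E B"
  unfolding finitary_functions_def arity_part_def by blast

lemma composition_in:
  assumes "f \<in> tuples A m \<rightarrow>\<^sub>E A" and "\<And>i. i < m \<Longrightarrow> g i \<in> tuples A n \<rightarrow>\<^sub>E A"
  shows "composition A m n f g \<in> tuples A n \<rightarrow>\<^sub>E A"
proof -
  have "f (\<lambda>i\<in>{..<m}. g i x) \<in> A" if "x \<in> tuples A n" for x
  proof -
    have "(\<lambda>i\<in>{..<m}. g i x) \<in> tuples A m"
      unfolding tuples_def by (rule restrict_PiE_iff[THEN iffD2]) (use assms(2) that in blast)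
    then show ?thesis using assms(1) by blast
  qed
  then show ?thesis by (auto simp: composition_def)
qed

lemma arity_part_finitary_functions:
  "f \<in> arity_part (finitary_functions A B) n \<longleftrightarrow> 0 < n \<and> f \<in> tuples A n \<rightarrow>\<^sub>E B"
  by (simp add: arity_part_def finitary_functions_def)

lemma arity_part_Inter: "arity_part (\<Inter>S) n = (\<Inter>C\<in>S. arity_part C n)"
  by (auto simp: arity_part_def)

lemma projection_in: "i < n \<Longrightarrow> projection A n i \<in> tuples A n \<rightarrow>\<^sub>E A"
  unfolding projection_def tuples_def by (rule restrict_PiE_iff[THEN iffD2]) blast

lemma is_clone_projection:
  "is_clone A C \<Longrightarrow> i < n \<Longrightarrow> projection A n i \<in> arity_part C n"
  by (simp add: is_clone_def)

lemma is_clone_composition: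
  assumes "is_clone A C" "0 < m" "0 < n" "f \<in> arity_part C m"
    and "\<And>i. i < m \<Longrightarrow> g i \<in> arity_part C n"
  shows "composition A m n f g \<in> arity_part C n"
proof -
  have "g \<in> {..<m} \<rightarrow> arity_part C n" using assms(5) by simp
  then show ?thesis using assms(1-4) by (simp add: is_clone_def)
qed

lemma is_cloneI:
  assumes "C \<subseteq> finitary_functions A A"
    and "\<And>n i. i < n \<Longrightarrow> projection A n i \<in> arity_part C n"
    and "\<And>m n f g. 0 < m \<Longrightarrow> 0 < n \<Longrightarrow> f \<in> arity_part C m \<Longrightarrow>
      (\<And>i. i < m \<Longrightarrow> g i \<in> arity_part C n) \<Longrightarrow> composition A m n f g \<in> arity_part C n"
  shows "is_clone A C"
  unfolding is_clone_def by (intro conjI allI impI ballI assms) (simp_all add: Pi_iff)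

lemma is_clone_all: "is_clone A (finitary_functions A A)"
proof (rule is_cloneI)
  fix m n :: nat and f g
  assume "0 < m" "0 < n" "f \<in> arity_part (finitary_functions A A) m"
    "\<And>i. i < m \<Longrightarrow> g i \<in> arity_part (finitary_functions A A) n"
  then show "composition A m n f g \<in> arity_part (finitary_functions A A) n"
    unfolding arity_part_finitary_functions by (intro conjI composition_in) simp_all
qed (auto simp: arity_part_finitary_functions intro!: projection_in)

lemma is_clone_Inter:
  assumes S: "\<And>C. C \<in> S \<Longrightarrow> is_clone A C" and "S \<noteq> {}"
  shows "is_clone A (\<Inter>S)"
proof (rule is_cloneI)
  obtain C where "C \<in> S" using \<open>S \<noteq> {}\<close> by blast
  moreover from this have "C \<subseteq> finitary_functions A A" using S by (simp add: is_clone_def)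
  ultimately show "\<Inter>S \<subseteq> finitary_functions A A" by blast
qed (auto simp: arity_part_Inter intro!: is_clone_projection is_clone_composition S)

definition addition :: "int \<Rightarrow> (nat \<Rightarrow> int) \<Rightarrow> int"
  where "addition N = reduced N N 2 (\<lambda>x. x 0 + x 1)"

lemma addition_clone_eq:
  "addition_clone (residue_ring N) = clone_generated (residue_set N) {(2, addition N)}"
  by (simp add: addition_clone_def addition_def reduced_def residue_ring_def)

lemma addition_clone_subset_iff:
  assumes "is_clone (residue_set N) K"
  shows "addition_clone (residue_ring N) \<subseteq> K \<longleftrightarrow> (2, addition N) \<in> K"
  using assms by (auto simp: addition_clone_eq clone_generated_def)

lemma closure_system_clones:
  assumes "N > 1"
  shows "closure_system (finitary_functions (residue_set N) (residue_set N))
    {K. is_clone (residue_set N) K \<and> addition_clone (residue_ring N) \<subseteq> K}"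
proof -
  have "(2, addition N) \<in> finitary_functions (residue_set N) (residue_set N)"
    using assms by (simp add: finitary_functions_def addition_def)
  then have "addition_clone (residue_ring N) \<subseteq> finitary_functions (residue_set N) (residue_set N)"
    by (simp add: addition_clone_subset_iff is_clone_all)
  moreover have "K \<subseteq> finitary_functions (residue_set N) (residue_set N)"
    if "is_clone (residue_set N) K" for K
    using that by (simp add: is_clone_def)
  moreover have "is_clone (residue_set N) (\<Inter>S) \<and> addition_clone (residue_ring N) \<subseteq> \<Inter>S"
    if "S \<subseteq> {K. is_clone (residue_set N) K \<and> addition_clone (residue_ring N) \<subseteq> K}" "S \<noteq> {}" for S
    using that by (auto intro!: is_clone_Inter)
  ultimately show ?thesis
    unfolding closure_system_def by (auto simp: is_clone_all)
qed

locale additive_clone =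
  fixes N :: int and K :: "(int, int) finfun set"
  assumes modulus: "N > 1"
    and clone: "is_clone (residue_set N) K"
    and addition: "addition N \<in> arity_part K 2"
begin

lemma operation: "F \<in> arity_part K n \<Longrightarrow> 0 < n \<and> F \<in> tuples (residue_set N) n \<rightarrow>\<^sub>E residue_set N"
  by (rule finitary_functionsD[of K]) (use clone in \<open>simp_all add: is_clone_def\<close>)

lemma composition:
  assumes "0 < m" "0 < n" "F \<in> arity_part K m" "\<And>i. i < m \<Longrightarrow> G i \<in> arity_part K n"
  shows "reduced N N n (\<lambda>x. F (\<lambda>i\<in>{..<m}. G i x)) \<in> arity_part K n"
proof -
  have *: "composition (residue_set N) m n F G \<in> arity_part K n"
    by (rule is_clone_composition[OF clone assms])
  have "composition (residue_set N) m n F G = reduced N N n (\<lambda>x. F (\<lambda>i\<in>{..<m}. G i x))"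
    by (rule reduced_eqI) (use operation[OF *] in \<open>auto simp: composition_def\<close>)
  with * show ?thesis by simp
qed

lemma sum_of_two:
  assumes F: "F \<in> arity_part K n" and G: "G \<in> arity_part K n"
  shows "reduced N N n (\<lambda>x. F x + G x) \<in> arity_part K n"
proof -
  define H where "H i = (if i = 0 then F else G)" for i :: nat
  have "reduced N N n (\<lambda>x. addition N (\<lambda>i\<in>{..<2}. H i x)) \<in> arity_part K n"
    by (rule composition) (use operation[OF F] addition F G in \<open>auto simp: H_def\<close>)
  also have "reduced N N n (\<lambda>x. addition N (\<lambda>i\<in>{..<2}. H i x)) = reduced N N n (\<lambda>x. F x + G x)"
  proof (rule reduced_cong)
    fix x assume "x \<in> tuples (residue_set N) n"
    then have "F x \<in> residue_set N" "G x \<in> residue_set N"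
      using operation F G by blast+
    then have "(\<lambda>i\<in>{..<2}. H i x) \<in> tuples (residue_set N) 2"
      by (auto simp: tuples_def H_def)
    then have "addition N (\<lambda>i\<in>{..<2}. H i x) = (F x + G x) mod N"
      by (simp add: addition_def H_def)
    then show "[addition N (\<lambda>i\<in>{..<2}. H i x) = F x + G x] (mod N)"
      by (simp add: cong_def)
  qed
  finally show ?thesis .
qed

lemma positive_multiple:
  assumes F: "F \<in> arity_part K n"
  shows "reduced N N n (\<lambda>x. (1 + int k) * F x) \<in> arity_part K n"
proof (induction k)
  case 0
  then show ?case using F operation[OF F] by (simp add: reduced_self)
next
  case (Suc k)
  have "reduced N N n (\<lambda>x. (1 + int (Suc k)) * F x) =
    reduced N N n (\<lambda>x. reduced N N n (\<lambda>x. (1 + int k) * F x) x + F x)"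
    by (rule reduced_cong) (simp add: cong_def mod_simps algebra_simps)
  then show ?case using sum_of_two[OF Suc.IH F] by simp
qed

text \<open>Subtraction is available because every integer is congruent modulo \<open>N\<close> to a positive
  one, so that repeated addition suffices.\<close>

lemma multiple:
  assumes F: "F \<in> arity_part K n"
  shows "reduced N N n (\<lambda>x. c * F x) \<in> arity_part K n"
proof -
  define k where "k = nat (c mod N + N - 1)"
  have "0 \<le> c mod N + N - 1"
    using modulus pos_mod_sign[of N c] by linarith
  then have "1 + int k = c mod N + N"
    unfolding k_def by (subst nat_0_le) simp_all
  then have "[c = 1 + int k] (mod N)" by (simp add: cong_def)
  then have "reduced N N n (\<lambda>x. c * F x) = reduced N N n (\<lambda>x. (1 + int k) * F x)"
    by (intro reduced_cong cong_mult) auto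
  then show ?thesis using positive_multiple[OF F] by simp
qed

lemma variable:
  assumes "i < n"
  shows "reduced N N n (\<lambda>x. x i) \<in> arity_part K n"
proof -
  have *: "projection (residue_set N) n i \<in> arity_part K n"
    by (rule is_clone_projection[OF clone assms])
  have "projection (residue_set N) n i = reduced N N n (\<lambda>x. x i)"
    by (rule reduced_eqI) (use operation[OF *] in \<open>auto simp: projection_def\<close>)
  with * show ?thesis by simp
qed

lemma linear_combination:
  fixes k :: nat
  assumes n: "0 < n" and F: "\<And>i. i < k \<Longrightarrow> F i \<in> arity_part K n"
  shows "reduced N N n (\<lambda>x. \<Sum>i<k. c i * F i x) \<in> arity_part K n"
  using F
proof (induction k)
  case 0
  \<comment> \<open>The zero operation arises as a multiple of a projection.\<close>
  show ?case using multiple[OF variable[OF n], of 0] by simp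
next
  case (Suc k)
  have "reduced N N n (\<lambda>x. \<Sum>i<Suc k. c i * F i x) = reduced N N n
    (\<lambda>x. reduced N N n (\<lambda>x. \<Sum>i<k. c i * F i x) x + reduced N N n (\<lambda>x. c k * F k x) x)"
    by (rule reduced_cong) (simp add: cong_def mod_simps)
  then show ?case
    using sum_of_two[OF Suc.IH multiple[of "F k"]] Suc.prems by simp
qed

lemma linear_form:
  assumes n: "0 < n"
  shows "reduced N N n (\<lambda>x. \<Sum>i<n. c i * x i) \<in> arity_part K n"
proof -
  have "reduced N N n (\<lambda>x. \<Sum>i<n. c i * x i) =
    reduced N N n (\<lambda>x. \<Sum>i<n. c i * reduced N N n (\<lambda>x. x i) x)"
    by (intro reduced_cong cong_sum cong_mult cong_refl) (simp add: cong_def)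
  then show ?thesis using linear_combination[OF n variable] by simp
qed

end

section \<open>Linearly closed clonoids between residue rings\<close>

text \<open>The coefficients matter only modulo \<open>p\<close> and the matrix entries only modulo \<open>q\<close>, so arbitrary
  integers may be admitted. The coefficients of linear forms modulo \<open>p q\<close> can then be used directly
  as coefficients and as matrix entries.\<close>

lemma clonoid_iff:
  assumes p: "p > 1" and q: "q > 1"
  shows "linearly_closed_clonoid (residue_ring p) (residue_ring q) C \<longleftrightarrow>
    C \<noteq> {} \<and> C \<subseteq> finitary_functions (residue_set q) (residue_set p) \<and>
    (\<forall>n>0. \<forall>f\<in>arity_part C n. \<forall>g\<in>arity_part C n. \<forall>a b.
      reduced q p n (\<lambda>x. a * f x + b * g x) \<in> arity_part C n) \<and>
    (\<forall>m>0. \<forall>n>0. \<forall>f\<in>arity_part C m. \<forall>A.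
      reduced q p n (\<lambda>x. f (reduced_tuple q m (\<lambda>i. \<Sum>j<n. A i j * x j))) \<in> arity_part C n)"
    (is "_ \<longleftrightarrow> C \<noteq> {} \<and> ?sub \<and> ?lin \<and> ?mat")
proof -
  let ?R = "residue_ring p" and ?S = "residue_ring q"
  interpret S: residues q ?S by unfold_locales (use q in auto)
  have lin: "(\<lambda>x\<in>tuples (residue_set q) n. a \<otimes>\<^bsub>?R\<^esub> f x \<oplus>\<^bsub>?R\<^esub> b \<otimes>\<^bsub>?R\<^esub> g x) =
    reduced q p n (\<lambda>x. a * f x + b * g x)" for n f g a b
    by (simp add: reduced_def residue_ring_def mod_simps)
  have mod_coeffs: "reduced q p n (\<lambda>x. a * f x + b * g x) =
    reduced q p n (\<lambda>x. (a mod p) * f x + (b mod p) * g x)" for n f g a b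
    by (intro reduced_cong cong_add cong_mult cong_refl) (simp_all add: cong_def)
  have mult: "mat_tuple_mult ?S m n A x = reduced_tuple q m (\<lambda>i. \<Sum>j<n. A i j * x j)" for m n A x
  proof -
    have "(\<Oplus>\<^bsub>?S\<^esub>j\<in>{..<n}. A i j \<otimes>\<^bsub>?S\<^esub> x j) = (\<Sum>j<n. A i j * x j) mod q" for i
      using S.sum_cong[of "{..<n}" "\<lambda>j. A i j * x j"] by (simp add: S.res_mult_eq)
    then show ?thesis by (simp add: mat_tuple_mult_def reduced_tuple_def)
  qed
  have mat: "(\<lambda>x\<in>tuples (residue_set q) n. f (mat_tuple_mult ?S m n A x)) =
      reduced q p n (\<lambda>x. f (reduced_tuple q m (\<lambda>i. \<Sum>j<n. A i j * x j)))"
    if "?sub" "f \<in> arity_part C m" for m n f A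
  proof (rule reduced_eqI)
    have f: "f \<in> tuples (residue_set q) m \<rightarrow>\<^sub>E residue_set p"
      using finitary_functionsD[OF that] by (rule conjunct2)
    have "f (reduced_tuple q m y) \<in> residue_set p" for y
      by (rule PiE_mem[OF f reduced_tuple_in[OF q]])
    then show "(\<lambda>x\<in>tuples (residue_set q) n. f (mat_tuple_mult ?S m n A x))
        \<in> tuples (residue_set q) n \<rightarrow>\<^sub>E residue_set p"
      unfolding mult restrict_PiE_iff by (intro ballI)
  qed (simp add: mult)
  have mod_entries: "reduced_tuple q m (\<lambda>i. \<Sum>j<n. A i j * x j) =
    reduced_tuple q m (\<lambda>i. \<Sum>j<n. (A i j mod q) * x j)" for m n A x
    by (intro reduced_tuple_cong cong_sum cong_mult cong_refl) (simp add: cong_def)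
  have lin_iff: "(\<forall>n>0. \<forall>f\<in>arity_part C n. \<forall>g\<in>arity_part C n. \<forall>a\<in>carrier ?R. \<forall>b\<in>carrier ?R.
      (\<lambda>x\<in>tuples (carrier ?S) n. a \<otimes>\<^bsub>?R\<^esub> f x \<oplus>\<^bsub>?R\<^esub> b \<otimes>\<^bsub>?R\<^esub> g x) \<in> arity_part C n) \<longleftrightarrow> ?lin"
  proof -
    have "(\<forall>a\<in>residue_set p. \<forall>b\<in>residue_set p.
        reduced q p n (\<lambda>x. a * f x + b * g x) \<in> arity_part C n) \<longleftrightarrow>
      (\<forall>a b. reduced q p n (\<lambda>x. a * f x + b * g x) \<in> arity_part C n)" (is "?l \<longleftrightarrow> ?r") for n f g
    proof
      assume l: ?l
      show ?r
      proof (intro allI)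
        fix a b
        have "a mod p \<in> residue_set p" "b mod p \<in> residue_set p" using p by simp_all
        then show "reduced q p n (\<lambda>x. a * f x + b * g x) \<in> arity_part C n"
          unfolding mod_coeffs[of n a f b g] by (rule l[THEN bspec, THEN bspec])
      qed
    qed simp
    then show ?thesis by (simp only: carrier_residue_ring lin)
  qed
  have mat_iff: "(\<forall>m>0. \<forall>n>0. \<forall>f\<in>arity_part C m. \<forall>A\<in>{..<m} \<rightarrow> {..<n} \<rightarrow> carrier ?S.
      (\<lambda>x\<in>tuples (carrier ?S) n. f (mat_tuple_mult ?S m n A x)) \<in> arity_part C n) \<longleftrightarrow> ?mat"
    if sub: ?sub
  proof -
    have "(\<forall>A\<in>{..<m} \<rightarrow> {..<n} \<rightarrow> carrier ?S.
        (\<lambda>x\<in>tuples (carrier ?S) n. f (mat_tuple_mult ?S m n A x)) \<in> arity_part C n) \<longleftrightarrow>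
      (\<forall>A. reduced q p n (\<lambda>x. f (reduced_tuple q m (\<lambda>i. \<Sum>j<n. A i j * x j))) \<in> arity_part C n)"
      (is "?l \<longleftrightarrow> ?r") if f: "f \<in> arity_part C m" for m n f
    proof
      assume l: ?l
      show ?r
      proof
        fix A
        have "(\<lambda>i j. A i j mod q) \<in> {..<m} \<rightarrow> {..<n} \<rightarrow> carrier ?S" using q by simp
        from l[THEN bspec, OF this]
        show "reduced q p n (\<lambda>x. f (reduced_tuple q m (\<lambda>i. \<Sum>j<n. A i j * x j))) \<in> arity_part C n"
          unfolding carrier_residue_ring mat[OF sub f] mod_entries[of m A] .
      qed
    qed (simp add: mat[OF sub f])
    then show ?thesis by (simp cong: ball_cong)
  qed
  show ?thesis
    unfolding linearly_closed_clonoid_def lin_iff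
    unfolding carrier_residue_ring
    by (intro conj_cong refl) (rule mat_iff[unfolded carrier_residue_ring])
qed

lemma clonoidI:
  assumes "p > 1" "q > 1"
    and "C \<noteq> {}" "C \<subseteq> finitary_functions (residue_set q) (residue_set p)"
    and "\<And>n f g a b. f \<in> arity_part C n \<Longrightarrow> g \<in> arity_part C n \<Longrightarrow>
      reduced q p n (\<lambda>x. a * f x + b * g x) \<in> arity_part C n"
    and "\<And>m n f A. 0 < m \<Longrightarrow> 0 < n \<Longrightarrow> f \<in> arity_part C m \<Longrightarrow>
      reduced q p n (\<lambda>x. f (reduced_tuple q m (\<lambda>i. \<Sum>j<n. A i j * x j))) \<in> arity_part C n"
  shows "linearly_closed_clonoid (residue_ring p) (residue_ring q) C"
  unfolding clonoid_iff[OF assms(1,2)] by (intro conjI allI impI ballI assms(3-))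

locale residue_clonoid =
  fixes p q :: int and C :: "(int, int) finfun set"
  assumes p: "p > 1" and q: "q > 1"
    and clonoid: "linearly_closed_clonoid (residue_ring p) (residue_ring q) C"
begin

lemma member: "f \<in> arity_part C n \<Longrightarrow> 0 < n \<and> f \<in> tuples (residue_set q) n \<rightarrow>\<^sub>E residue_set p"
  by (rule finitary_functionsD[of C])
    (use clonoid in \<open>simp_all add: linearly_closed_clonoid_def\<close>)

lemma linear_combination_of_two:
  assumes "f \<in> arity_part C n" "g \<in> arity_part C n"
  shows "reduced q p n (\<lambda>x. a * f x + b * g x) \<in> arity_part C n"
  using clonoid assms member[OF assms(1)] by (simp add: clonoid_iff[OF p q])

lemma substitution:
  assumes "0 < n" "f \<in> arity_part C m"
  shows "reduced q p n (\<lambda>x. f (reduced_tuple q m (\<lambda>i. \<Sum>j<n. A i j * x j))) \<in> arity_part C n"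
  using clonoid assms member[OF assms(2)] by (simp add: clonoid_iff[OF p q])

text \<open>Non-emptiness provides a member of some arity; scaling by \<open>0\<close> and substituting a zero
  matrix turns it into the zero function of every arity.\<close>

lemma zero:
  assumes n: "0 < n"
  shows "reduced q p n (\<lambda>x. 0) \<in> arity_part C n"
proof -
  from clonoid have "C \<noteq> {}" by (simp add: linearly_closed_clonoid_def)
  then obtain m f where f: "f \<in> arity_part C m" by (auto simp: arity_part_def)
  have 0: "reduced q p m (\<lambda>x. 0) \<in> arity_part C m"
    using linear_combination_of_two[OF f f, of 0 0] by simp
  show ?thesis using substitution[OF n 0, of "\<lambda>i j. 0"] q by simp
qed

lemma affine_combination:
  fixes k :: nat
  assumes f: "f \<in> arity_part C n" and g: "\<And>i. i < k \<Longrightarrow> g i \<in> arity_part C n"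
  shows "reduced q p n (\<lambda>x. (\<Sum>i<k. c i * g i x) + f x) \<in> arity_part C n"
  using g
proof (induction k)
  case 0
  then show ?case using f member[OF f] by (simp add: reduced_self)
next
  case (Suc k)
  have "reduced q p n (\<lambda>x. (\<Sum>i<Suc k. c i * g i x) + f x) =
    reduced q p n (\<lambda>x. 1 * reduced q p n (\<lambda>x. (\<Sum>i<k. c i * g i x) + f x) x + c k * g k x)"
    by (rule reduced_cong) (simp add: cong_def mod_simps algebra_simps)
  moreover have "reduced q p n (\<lambda>x. (\<Sum>i<k. c i * g i x) + f x) \<in> arity_part C n" "g k \<in> arity_part C n"
    using Suc by auto
  ultimately show ?case
    using linear_combination_of_two[of _ n "g k" 1 "c k"] by presburger
qed

end

lemma closure_system_clonoids:
  assumes p: "p > 1" and q: "q > 1"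
  shows "closure_system (finitary_functions (residue_set q) (residue_set p))
    {C. linearly_closed_clonoid (residue_ring p) (residue_ring q) C}"
proof -
  let ?T = "finitary_functions (residue_set q) (residue_set p)"
  let ?X = "{C. linearly_closed_clonoid (residue_ring p) (residue_ring q) C}"
  have "?T \<in> ?X"
  proof -
    have "(1, reduced q p 1 (\<lambda>x. 0)) \<in> ?T" using p by (simp add: finitary_functions_def)
    then have "?T \<noteq> {}" by blast
    then show ?thesis
      using p by (auto simp: clonoid_iff[OF p q] finitary_functions_def arity_part_def)
  qed
  moreover have "C \<subseteq> ?T" if "C \<in> ?X" for C
    using that by (simp add: linearly_closed_clonoid_def)
  moreover have "\<Inter>S \<in> ?X" if S: "S \<subseteq> ?X" "S \<noteq> {}" for S
  proof -
    have C: "residue_clonoid p q C" if "C \<in> S" for C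
      using that S p q by unfold_locales auto
    have "(1, reduced q p 1 (\<lambda>x. 0)) \<in> \<Inter>S"
      using residue_clonoid.zero[OF C, of _ 1] by (auto simp: arity_part_def)
    then have "\<Inter>S \<noteq> {}" by blast
    moreover have "\<Inter>S \<subseteq> ?T"
    proof -
      obtain C where "C \<in> S" using S by blast
      then have "C \<subseteq> ?T" using S by (auto simp: linearly_closed_clonoid_def)
      then show ?thesis using \<open>C \<in> S\<close> by blast
    qed
    ultimately show ?thesis
      unfolding mem_Collect_eq clonoid_iff[OF p q] arity_part_Inter
    proof (intro conjI allI impI ballI INT_I)
      fix n f g a b C
      assume "f \<in> (\<Inter>C\<in>S. arity_part C n)" "g \<in> (\<Inter>C\<in>S. arity_part C n)" "C \<in> S"
      then show "reduced q p n (\<lambda>x. a * f x + b * g x) \<in> arity_part C n"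
        by (intro residue_clonoid.linear_combination_of_two[OF C]) simp_all
    next
      fix m n :: nat and f A C
      assume "0 < n" "f \<in> (\<Inter>C\<in>S. arity_part C m)" "C \<in> S"
      then show "reduced q p n (\<lambda>x. f (reduced_tuple q m (\<lambda>i. \<Sum>j<n. A i j * x j)))
          \<in> arity_part C n"
        by (intro residue_clonoid.substitution[OF C]) simp_all
    qed
  qed
  ultimately show ?thesis by (rule closure_systemI)
qed

section \<open>The Galois connection\<close>

locale split_modulus =
  fixes p q e :: int
  assumes p: "p > 1" and q: "q > 1"
    and e_mod_p: "[e = 1] (mod p)" and q_dvd_e: "q dvd e"
begin

text \<open>In the decomposition of the residues modulo \<open>p q\<close> into residues modulo \<open>p\<close> and modulo \<open>q\<close>,
  this is the operation whose \<open>p\<close>-component is a linear form plus \<open>f\<close> applied to the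
  \<open>q\<close>-components, and whose \<open>q\<close>-component is a linear form alone.\<close>

definition op_of :: "nat \<Rightarrow> (nat \<Rightarrow> int) \<Rightarrow> ((nat \<Rightarrow> int) \<Rightarrow> int) \<Rightarrow> (nat \<Rightarrow> int) \<Rightarrow> int"
  where "op_of n c f =
    reduced (p * q) (p * q) n (\<lambda>x. (\<Sum>i<n. c i * x i) + e * f (reduced_tuple q n x))"

definition clone_of :: "(int, int) finfun set \<Rightarrow> (int, int) finfun set"
  where "clone_of C = {(n, F). \<exists>c f. f \<in> arity_part C n \<and> F = op_of n c f}"

definition clonoid_of :: "(int, int) finfun set \<Rightarrow> (int, int) finfun set"
  where "clonoid_of K = {(n, f). f \<in> tuples (residue_set q) n \<rightarrow>\<^sub>E residue_set p \<and>
    op_of n (\<lambda>i. 0) f \<in> arity_part K n}"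

lemma modulus: "p * q > 1"
  using p q by (rule less_1_mult)

lemma arity_part_clone_of:
  "F \<in> arity_part (clone_of C) n \<longleftrightarrow> (\<exists>c f. f \<in> arity_part C n \<and> F = op_of n c f)"
  by (simp add: arity_part_def clone_of_def)

lemma op_of_in_clone_of:
  "f \<in> arity_part C n \<Longrightarrow> op_of n c f \<in> arity_part (clone_of C) n"
  unfolding arity_part_clone_of by blast

lemma arity_part_clonoid_of:
  "f \<in> arity_part (clonoid_of K) n \<longleftrightarrow>
    f \<in> tuples (residue_set q) n \<rightarrow>\<^sub>E residue_set p \<and> op_of n (\<lambda>i. 0) f \<in> arity_part K n"
  by (simp add: arity_part_def clonoid_of_def)

text \<open>The factor \<open>e\<close> contributes the divisor \<open>q\<close>. Hence values of clonoid members, which are only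
  meaningful modulo \<open>p\<close>, can be used in computations modulo \<open>p q\<close> once they are multiplied by \<open>e\<close>.\<close>

lemma e_cong: "[a = b] (mod p) \<Longrightarrow> [e * a = e * b] (mod p * q)"
proof -
  assume "[a = b] (mod p)"
  then have "p dvd a - b" by (simp add: cong_iff_dvd_diff)
  then have "q * p dvd e * (a - b)" by (rule mult_dvd_mono[OF q_dvd_e])
  then show ?thesis by (simp add: cong_iff_dvd_diff algebra_simps)
qed

lemma op_of_apply:
  "x \<in> tuples (residue_set (p * q)) n \<Longrightarrow>
    [op_of n c f x = (\<Sum>i<n. c i * x i) + e * f (reduced_tuple q n x)] (mod p * q)"
  by (simp add: op_of_def cong_def)

lemma op_of_in: "op_of n c f \<in> tuples (residue_set (p * q)) n \<rightarrow>\<^sub>E residue_set (p * q)"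
  unfolding op_of_def by (rule reduced_in[OF modulus])

text \<open>The value of \<open>f\<close> at \<open>y\<close> is read off at the argument \<open>(1 - e) y\<close>, which is congruent to \<open>0\<close>
  modulo \<open>p\<close> and to \<open>y\<close> modulo \<open>q\<close>.\<close>

lemma op_of_determines:
  assumes f: "f \<in> tuples (residue_set q) n \<rightarrow>\<^sub>E residue_set p"
    and g: "g \<in> tuples (residue_set q) n \<rightarrow>\<^sub>E residue_set p"
    and eq: "op_of n c f = op_of n d g"
  shows "f = g"
proof -
  have read_off: "[op_of n c f (reduced_tuple (p * q) n (\<lambda>i. (1 - e) * y i)) = f y] (mod p)"
    if y: "y \<in> tuples (residue_set q) n" for c f y
  proof -
    define x where "x = reduced_tuple (p * q) n (\<lambda>i. (1 - e) * y i)"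
    have x: "x \<in> tuples (residue_set (p * q)) n"
      unfolding x_def by (rule reduced_tuple_in[OF modulus])
    have x_i: "[x i = (1 - e) * y i] (mod p * q)" if "i < n" for i
      using that by (simp add: x_def reduced_tuple_apply cong_def)
    have "reduced_tuple q n x = reduced_tuple q n y"
    proof (rule reduced_tuple_cong)
      fix i assume "i < n"
      have "[x i = (1 - e) * y i] (mod q)"
        using cong_modulus_mult[of "x i" _ q p] x_i[OF \<open>i < n\<close>] by (simp add: mult.commute)
      also have "[(1 - e) * y i = y i] (mod q)"
        using q_dvd_e by (simp add: cong_iff_dvd_diff algebra_simps)
      finally show "[x i = y i] (mod q)" .
    qed
    then have red: "reduced_tuple q n x = y" using y by (simp add: reduced_tuple_self)
    have "[op_of n c f x = (\<Sum>i<n. c i * x i) + e * f y] (mod p)"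
      using op_of_apply[OF x, of c f] cong_modulus_mult unfolding red by blast
    also have "[(\<Sum>i<n. c i * x i) + e * f y = (\<Sum>i<n. c i * 0) + 1 * f y] (mod p)"
    proof (intro cong_add cong_sum cong_mult cong_refl e_mod_p)
      fix i assume "i \<in> {..<n}"
      then have "[x i = (1 - e) * y i] (mod p)"
        using x_i cong_modulus_mult by blast
      also have "[(1 - e) * y i = 0] (mod p)"
      proof -
        have "p dvd 1 - e" using e_mod_p by (simp add: cong_iff_dvd_diff dvd_diff_commute)
        then show ?thesis by (simp add: cong_0_iff)
      qed
      finally show "[x i = 0] (mod p)" .
    qed
    finally show ?thesis by (simp add: x_def)
  qed
  have "[f y = g y] (mod p)" if "y \<in> tuples (residue_set q) n" for y
    using read_off[OF that, of c f] read_off[OF that, of d g] eq by (metis cong_sym cong_trans)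
  then have "reduced q p n f = reduced q p n g" by (rule reduced_cong)
  then show ?thesis using f g by (simp add: reduced_self)
qed

text \<open>The closure of the clone under composition, as an explicit formula: the coefficients are
  multiplied as matrices, and the new nonlinear part is built from \<open>f\<close> and the \<open>g i\<close> by the
  operations of a clonoid.\<close>

lemma composition_op_of:
  "composition (residue_set (p * q)) m n (op_of m c f) (\<lambda>i. op_of n (d i) (g i)) =
    op_of n (\<lambda>j. \<Sum>i<m. c i * d i j)
      (reduced q p n (\<lambda>y. (\<Sum>i<m. c i * g i y) +
        reduced q p n (\<lambda>y. f (reduced_tuple q m (\<lambda>i. \<Sum>j<n. d i j * y j))) y))"
    (is "?L = op_of n ?c ?f")
  unfolding op_of_def[of n ?c ?f]
proof (rule reduced_eqI)
  show "?L \<in> tuples (residue_set (p * q)) n \<rightarrow>\<^sub>E residue_set (p * q)"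
    by (intro composition_in op_of_in)
next
  fix x assume x: "x \<in> tuples (residue_set (p * q)) n"
  define y where "y = reduced_tuple q n x"
  have y: "y \<in> tuples (residue_set q) n" unfolding y_def using q by simp
  define z where "z = (\<lambda>i\<in>{..<m}. op_of n (d i) (g i) x)"
  have z: "z \<in> tuples (residue_set (p * q)) m"
    unfolding z_def tuples_def
    by (rule restrict_PiE_iff[THEN iffD2]) (use op_of_in x in blast)
  have z_i: "[z i = (\<Sum>j<n. d i j * x j) + e * g i y] (mod p * q)" if "i < m" for i
    using op_of_apply[OF x] that by (simp add: z_def y_def)
  define v where "v = f (reduced_tuple q m (\<lambda>i. \<Sum>j<n. d i j * y j))"
  have inner: "reduced_tuple q m z = reduced_tuple q m (\<lambda>i. \<Sum>j<n. d i j * y j)"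
  proof (rule reduced_tuple_cong)
    fix i assume "i < m"
    have "[z i = (\<Sum>j<n. d i j * x j) + e * g i y] (mod q)"
      using cong_modulus_mult[of "z i" _ q p] z_i[OF \<open>i < m\<close>] by (simp add: mult.commute)
    also have "[(\<Sum>j<n. d i j * x j) + e * g i y = (\<Sum>j<n. d i j * y j) + 0] (mod q)"
    proof (intro cong_add cong_sum cong_mult cong_refl)
      show "[e * g i y = 0] (mod q)" using q_dvd_e by (simp add: cong_0_iff)
    qed (simp add: y_def reduced_tuple_apply cong_def)
    finally show "[z i = (\<Sum>j<n. d i j * y j)] (mod q)" by simp
  qed
  have "?L x = op_of m c f z" using x by (simp add: composition_def z_def)
  also have "[op_of m c f z = (\<Sum>i<m. c i * z i) + e * v] (mod p * q)"
    using op_of_apply[OF z, of c f] by (simp add: inner v_def)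
  also have "[(\<Sum>i<m. c i * z i) + e * v =
      (\<Sum>i<m. c i * ((\<Sum>j<n. d i j * x j) + e * g i y)) + e * v] (mod p * q)"
    by (intro cong_add cong_sum cong_mult cong_refl z_i) simp
  also have "(\<Sum>i<m. c i * ((\<Sum>j<n. d i j * x j) + e * g i y)) + e * v =
      (\<Sum>j<n. ?c j * x j) + e * ((\<Sum>i<m. c i * g i y) + v)"
  proof -
    have "(\<Sum>i<m. c i * (\<Sum>j<n. d i j * x j)) = (\<Sum>j<n. ?c j * x j)"
      unfolding sum_distrib_left sum_distrib_right
      by (subst sum.swap) (simp add: mult.assoc)
    then show ?thesis
      by (simp add: distrib_left sum.distrib sum_distrib_left mult.left_commute)
  qed
  also have "[(\<Sum>j<n. ?c j * x j) + e * ((\<Sum>i<m. c i * g i y) + v) =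
      (\<Sum>j<n. ?c j * x j) + e * ?f y] (mod p * q)"
    by (intro cong_add e_cong cong_refl) (use y in \<open>simp add: cong_def mod_simps v_def\<close>)
  finally show "[?L x = (\<Sum>j<n. ?c j * x j) + e * ?f (reduced_tuple q n x)] (mod p * q)"
    by (simp add: y_def)
qed

lemma linear_op_of:
  "op_of n c (reduced q p n (\<lambda>x. 0)) = reduced (p * q) (p * q) n (\<lambda>x. \<Sum>i<n. c i * x i)"
  unfolding op_of_def by (rule reduced_cong) (use q in simp)

text \<open>Projections and the addition are linear forms, that is, they have nonlinear part zero.\<close>

lemma clone_of_clone:
  assumes "linearly_closed_clonoid (residue_ring p) (residue_ring q) C"
  shows "is_clone (residue_set (p * q)) (clone_of C)"
    and "addition_clone (residue_ring (p * q)) \<subseteq> clone_of C"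
proof -
  interpret C: residue_clonoid p q C by unfold_locales (use p q assms in auto)
  have linear: "reduced (p * q) (p * q) n (\<lambda>x. \<Sum>i<n. c i * x i) \<in> arity_part (clone_of C) n"
    if "0 < n" for n c
    unfolding linear_op_of[symmetric] by (intro op_of_in_clone_of C.zero that)
  show clone: "is_clone (residue_set (p * q)) (clone_of C)"
  proof (rule is_cloneI)
    show "clone_of C \<subseteq> finitary_functions (residue_set (p * q)) (residue_set (p * q))"
      using op_of_in C.member by (auto simp: clone_of_def finitary_functions_def)
  next
    fix n i :: nat assume "i < n"
    have "projection (residue_set (p * q)) n i =
      reduced (p * q) (p * q) n (\<lambda>x. \<Sum>j<n. (if j = i then 1 else 0) * x j)"
    proof (rule reduced_eqI[OF projection_in[OF \<open>i < n\<close>]])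
      fix x assume "x \<in> tuples (residue_set (p * q)) n"
      moreover have "(\<Sum>j<n. (if j = i then 1 else 0) * x j) = x i"
        using \<open>i < n\<close> by (simp add: if_distrib[of "\<lambda>a. a * _"] cong: if_cong)
      ultimately show "[projection (residue_set (p * q)) n i x =
          (\<Sum>j<n. (if j = i then 1 else 0) * x j)] (mod p * q)"
        by (simp add: projection_def)
    qed
    then show "projection (residue_set (p * q)) n i \<in> arity_part (clone_of C) n"
      using linear \<open>i < n\<close> by simp
  next
    fix m n :: nat and F G
    assume m: "0 < m" and n: "0 < n" and F: "F \<in> arity_part (clone_of C) m"
      and G: "\<And>i. i < m \<Longrightarrow> G i \<in> arity_part (clone_of C) n"
    obtain c f where f: "f \<in> arity_part C m" and F_eq: "F = op_of m c f"
      using F unfolding arity_part_clone_of by blast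
    have "\<forall>i<m. \<exists>d g. g \<in> arity_part C n \<and> G i = op_of n d g"
      using G by (simp add: arity_part_clone_of)
    then obtain d g where g: "\<And>i. i < m \<Longrightarrow> g i \<in> arity_part C n"
      and G_eq: "\<And>i. i < m \<Longrightarrow> G i = op_of n (d i) (g i)"
      by metis
    have "composition (residue_set (p * q)) m n F G =
      composition (residue_set (p * q)) m n (op_of m c f) (\<lambda>i. op_of n (d i) (g i))"
      unfolding composition_def F_eq
      by (intro restrict_ext arg_cong[where f = "op_of m c f"]) (simp add: G_eq)
    also have "\<dots> \<in> arity_part (clone_of C) n"
      unfolding composition_op_of
      by (intro op_of_in_clone_of C.affine_combination C.substitution n f g)
    finally show "composition (residue_set (p * q)) m n F G \<in> arity_part (clone_of C) n" .
  qed
  have "addition (p * q) = reduced (p * q) (p * q) 2 (\<lambda>x. \<Sum>i<2. 1 * x i)"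
    by (simp add: addition_def numeral_2_eq_2)
  then have "addition (p * q) \<in> arity_part (clone_of C) 2"
    using linear[of 2 "\<lambda>i. 1"] by simp
  then show "addition_clone (residue_ring (p * q)) \<subseteq> clone_of C"
    by (simp add: addition_clone_subset_iff[OF clone] arity_part_def)
qed

lemma additive_clone:
  assumes "is_clone (residue_set (p * q)) K" "addition_clone (residue_ring (p * q)) \<subseteq> K"
  shows "additive_clone (p * q) K"
  using assms modulus by unfold_locales (auto simp: addition_clone_subset_iff arity_part_def)

lemma nonlinear_apply:
  "x \<in> tuples (residue_set (p * q)) n \<Longrightarrow>
    [op_of n (\<lambda>i. 0) f x = e * f (reduced_tuple q n x)] (mod p * q)"
  using op_of_apply[of x n "\<lambda>i. 0" f] by simp

text \<open>Linear combinations of operations of \<open>K\<close>, and substitutions of linear forms into them, stay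
  in \<open>K\<close>; both commute with the passage from \<open>f\<close> to \<open>e f(x mod q)\<close>.\<close>

lemma clonoid_of_clonoid:
  assumes "additive_clone (p * q) K"
  shows "linearly_closed_clonoid (residue_ring p) (residue_ring q) (clonoid_of K)"
proof -
  interpret K: additive_clone "p * q" K by (rule assms)
  let ?N = "p * q"
  have "reduced q p 1 (\<lambda>x. 0) \<in> arity_part (clonoid_of K) 1"
    using K.linear_form[of 1 "\<lambda>i. 0"] p by (simp add: arity_part_clonoid_of linear_op_of)
  then have "clonoid_of K \<noteq> {}" by (auto simp: arity_part_def)
  moreover have "clonoid_of K \<subseteq> finitary_functions (residue_set q) (residue_set p)"
    using K.operation by (auto simp: clonoid_of_def finitary_functions_def)
  moreover have "reduced q p n (\<lambda>x. a * f x + b * g x) \<in> arity_part (clonoid_of K) n"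
    if f: "f \<in> arity_part (clonoid_of K) n" and g: "g \<in> arity_part (clonoid_of K) n" for n f g a b
  proof -
    let ?h = "reduced q p n (\<lambda>x. a * f x + b * g x)"
    let ?F = "op_of n (\<lambda>i. 0) f" and ?G = "op_of n (\<lambda>i. 0) g"
    have F: "?F \<in> arity_part K n" and G: "?G \<in> arity_part K n"
      using f g by (auto simp: arity_part_clonoid_of)
    have "op_of n (\<lambda>i. 0) ?h =
      reduced ?N ?N n (\<lambda>x. reduced ?N ?N n (\<lambda>x. a * ?F x) x + reduced ?N ?N n (\<lambda>x. b * ?G x) x)"
    proof (rule reduced_eqI[OF op_of_in])
      fix x assume x: "x \<in> tuples (residue_set ?N) n"
      let ?y = "reduced_tuple q n x"
      have "[op_of n (\<lambda>i. 0) ?h x = e * ?h ?y] (mod ?N)" by (rule nonlinear_apply[OF x])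
      also have "[e * ?h ?y = e * (a * f ?y + b * g ?y)] (mod ?N)"
        by (rule e_cong) (use q in \<open>simp add: cong_def\<close>)
      also have "e * (a * f ?y + b * g ?y) = a * (e * f ?y) + b * (e * g ?y)"
        by (simp add: algebra_simps)
      also have "[a * (e * f ?y) + b * (e * g ?y) = a * ?F x + b * ?G x] (mod ?N)"
        by (intro cong_add cong_mult cong_refl cong_sym[OF nonlinear_apply[OF x]])
      also have "[a * ?F x + b * ?G x =
          reduced ?N ?N n (\<lambda>x. a * ?F x) x + reduced ?N ?N n (\<lambda>x. b * ?G x) x] (mod ?N)"
        using x by (simp add: cong_def mod_simps)
      finally show "[op_of n (\<lambda>i. 0) ?h x =
          reduced ?N ?N n (\<lambda>x. a * ?F x) x + reduced ?N ?N n (\<lambda>x. b * ?G x) x] (mod ?N)" .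
    qed
    then show ?thesis
      using K.sum_of_two[OF K.multiple[OF F] K.multiple[OF G]] p
      by (simp add: arity_part_clonoid_of)
  qed
  moreover have "reduced q p n (\<lambda>x. f (reduced_tuple q m (\<lambda>i. \<Sum>j<n. A i j * x j)))
      \<in> arity_part (clonoid_of K) n"
    if m: "0 < m" and n: "0 < n" and f: "f \<in> arity_part (clonoid_of K) m" for m n f A
  proof -
    let ?h = "reduced q p n (\<lambda>x. f (reduced_tuple q m (\<lambda>i. \<Sum>j<n. A i j * x j)))"
    let ?L = "\<lambda>i. reduced ?N ?N n (\<lambda>x. \<Sum>j<n. A i j * x j)"
    let ?F = "op_of m (\<lambda>i. 0) f"
    have "op_of n (\<lambda>i. 0) ?h = reduced ?N ?N n (\<lambda>x. ?F (\<lambda>i\<in>{..<m}. ?L i x))"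
    proof (rule reduced_eqI[OF op_of_in])
      fix x assume x: "x \<in> tuples (residue_set ?N) n"
      let ?y = "reduced_tuple q n x" and ?z = "\<lambda>i\<in>{..<m}. ?L i x"
      have z_eq: "?z = reduced_tuple ?N m (\<lambda>i. \<Sum>j<n. A i j * x j)"
        using x by (simp add: reduced_tuple_def)
      have z: "?z \<in> tuples (residue_set ?N) m"
        unfolding z_eq by (rule reduced_tuple_in[OF modulus])
      have "reduced_tuple q m ?z = reduced_tuple q m (\<lambda>i. \<Sum>j<n. A i j * ?y j)"
      proof (rule reduced_tuple_cong)
        fix i assume "i < m"
        have "[?z i = (\<Sum>j<n. A i j * x j)] (mod q)"
          using \<open>i < m\<close> x by (simp add: cong_def mod_mod_cancel)
        also have "[(\<Sum>j<n. A i j * x j) = (\<Sum>j<n. A i j * ?y j)] (mod q)"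
          by (intro cong_sum cong_mult cong_refl) (simp add: reduced_tuple_apply cong_def)
        finally show "[?z i = (\<Sum>j<n. A i j * ?y j)] (mod q)" .
      qed
      then have "[e * ?h ?y = e * f (reduced_tuple q m ?z)] (mod ?N)"
        by (intro e_cong) (use q in \<open>simp add: cong_def\<close>)
      then have "[op_of n (\<lambda>i. 0) ?h x = e * f (reduced_tuple q m ?z)] (mod ?N)"
        by (rule cong_trans[OF nonlinear_apply[OF x]])
      then show "[op_of n (\<lambda>i. 0) ?h x = ?F ?z] (mod ?N)"
        using cong_sym[OF nonlinear_apply[OF z]] by (rule cong_trans)
    qed
    moreover have "reduced ?N ?N n (\<lambda>x. ?F (\<lambda>i\<in>{..<m}. ?L i x)) \<in> arity_part K n"
      using f m n by (intro K.composition K.linear_form) (auto simp: arity_part_clonoid_of)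
    ultimately show ?thesis using p by (simp add: arity_part_clonoid_of)
  qed
  ultimately show ?thesis by (rule clonoidI[OF p q])
qed

text \<open>The Galois connection: a member of \<open>clone_of C\<close> is the sum of a linear form, which every clone
  containing the addition has, and of an operation with zero linear part.\<close>

lemma clone_of_subset_iff:
  assumes C: "linearly_closed_clonoid (residue_ring p) (residue_ring q) C"
    and K: "additive_clone (p * q) K"
  shows "clone_of C \<subseteq> K \<longleftrightarrow> C \<subseteq> clonoid_of K"
proof -
  interpret C: residue_clonoid p q C by unfold_locales (use p q C in auto)
  interpret K: additive_clone "p * q" K by (rule K)
  let ?N = "p * q"
  show ?thesis
  proof
    assume *: "clone_of C \<subseteq> K"
    show "C \<subseteq> clonoid_of K"
    proof clarify
      fix n f assume "(n, f) \<in> C"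
      then have f: "f \<in> arity_part C n" by (simp add: arity_part_def)
      then have "(n, op_of n (\<lambda>i. 0) f) \<in> clone_of C" by (auto simp: clone_of_def)
      with * C.member[OF f] show "(n, f) \<in> clonoid_of K"
        by (auto simp: clonoid_of_def arity_part_def)
    qed
  next
    assume *: "C \<subseteq> clonoid_of K"
    show "clone_of C \<subseteq> K"
    proof clarify
      fix n F assume "(n, F) \<in> clone_of C"
      then obtain c f where f: "f \<in> arity_part C n" and F: "F = op_of n c f"
        by (auto simp: clone_of_def)
      have n: "0 < n" using C.member[OF f] by simp
      have "f \<in> arity_part (clonoid_of K) n" using f * by (auto simp: arity_part_def)
      then have "op_of n (\<lambda>i. 0) f \<in> arity_part K n" by (simp add: arity_part_clonoid_of)
      note sum = K.sum_of_two[OF K.linear_form[OF n, of c] this]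
      have "op_of n c f = reduced ?N ?N n
        (\<lambda>x. reduced ?N ?N n (\<lambda>x. \<Sum>i<n. c i * x i) x + op_of n (\<lambda>i. 0) f x)"
        unfolding op_of_def by (rule reduced_cong) (simp add: cong_def mod_simps)
      then show "(n, F) \<in> K" using sum F by (simp add: arity_part_def)
    qed
  qed
qed

lemma clonoid_of_clone_of:
  assumes C: "linearly_closed_clonoid (residue_ring p) (residue_ring q) C"
  shows "clonoid_of (clone_of C) = C"
proof
  interpret C: residue_clonoid p q C by unfold_locales (use p q C in auto)
  show "C \<subseteq> clonoid_of (clone_of C)"
    using clone_of_subset_iff[OF C additive_clone[OF clone_of_clone[OF C]]] by simp
  show "clonoid_of (clone_of C) \<subseteq> C"
  proof clarify
    fix n f assume "(n, f) \<in> clonoid_of (clone_of C)"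
    then have f: "f \<in> tuples (residue_set q) n \<rightarrow>\<^sub>E residue_set p"
      and "op_of n (\<lambda>i. 0) f \<in> arity_part (clone_of C) n"
      by (auto simp: clonoid_of_def)
    then obtain c g where g: "g \<in> arity_part C n" and eq: "op_of n (\<lambda>i. 0) f = op_of n c g"
      unfolding arity_part_clone_of by blast
    have "f = g" using op_of_determines[OF f _ eq] C.member[OF g] by blast
    then show "(n, f) \<in> C" using g by (simp add: arity_part_def)
  qed
qed

lemma clone_of_Int:
  assumes C: "linearly_closed_clonoid (residue_ring p) (residue_ring q) C"
    and D: "linearly_closed_clonoid (residue_ring p) (residue_ring q) D"
  shows "clone_of (C \<inter> D) = clone_of C \<inter> clone_of D"
proof
  interpret C: residue_clonoid p q C by unfold_locales (use p q C in auto)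
  interpret D: residue_clonoid p q D by unfold_locales (use p q D in auto)
  show "clone_of (C \<inter> D) \<subseteq> clone_of C \<inter> clone_of D"
    by (auto simp: clone_of_def arity_part_def)
  show "clone_of C \<inter> clone_of D \<subseteq> clone_of (C \<inter> D)"
  proof clarify
    fix n F assume "(n, F) \<in> clone_of C" "(n, F) \<in> clone_of D"
    then obtain c f d g where f: "f \<in> arity_part C n" "F = op_of n c f"
      and g: "g \<in> arity_part D n" "F = op_of n d g"
      unfolding clone_of_def by blast
    have "f = g"
      using op_of_determines[of f n g c d] f g C.member[OF f(1)] D.member[OF g(1)] by simp
    then show "(n, F) \<in> clone_of (C \<inter> D)"
      using f g by (auto simp: clone_of_def arity_part_def)
  qed
qed

lemma lattice_embedding_clone_of:
  "lattice_embedding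
    (inclusion_order {C. linearly_closed_clonoid (residue_ring p) (residue_ring q) C})
    (inclusion_order {K. is_clone (residue_set (p * q)) K \<and> addition_clone (residue_ring (p * q)) \<subseteq> K})
    clone_of"
  by (rule lattice_embedding_of_adjunction[OF closure_system_clonoids[OF p q]
        closure_system_clones[OF modulus], where g = clonoid_of])
    (simp_all add: clone_of_clone clone_of_Int clonoid_of_clone_of clonoid_of_clonoid
      additive_clone clone_of_subset_iff)

end

theorem theorem1p2:
  fixes p q :: nat
  assumes "prime p" and "prime q" and "p \<noteq> q"
  shows "\<exists>h. lattice_embedding (clonoid_lattice p q) (clone_lattice_above_addition (p * q)) h"
proof -
  have "coprime (int p) (int q)"
    using assms by (simp add: primes_coprime)
  then obtain e where "[e = 1] (mod int p)" "[e = 0] (mod int q)"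
    using binary_chinese_remainder_int by blast
  then interpret split_modulus "int p" "int q" e
    using assms by unfold_locales (auto simp: cong_0_iff dest: prime_gt_1_nat)
  show ?thesis
    using lattice_embedding_clone_of
    unfolding clonoid_lattice_def clone_lattice_above_addition_def by auto
qed

end
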